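(* Let $n\geqslant 2$, $r\geqslant 1$ and $s\geqslant 0$ be integers. Then, modulo $(1+q^{2n-2})^{2r-2}[n]_{q^2}{2n-1\brack n-1}_{q^2}$, \begin{align*} \sum_{k=0}^{n-1}(-1)^kq^{2k^2+(2r-4s-4)k}[4k+1]_q^{2s}[4k+1]_{q^2}{2k\brack k}^{2r-1}_{q^2}(-q^{2k+2};q^2)_{n-k-1}^{4r-2} &\equiv 0,\\ \frac{1}{1+q^{2n-2}}\sum_{k=0}^{n-1}q^{(2r-4s-4)k}[4k+1]_q^{2s}[4k+1]_{q^2}{2k\brack k}^{2r}_{q^2}(-q^{2k+2};q^2)_{n-k-1}^{4r} &\equiv 0. \end{align*}
   Context: For an indeterminate $q$ and a nonnegative integer $m$, the $q$-shifted factorial is $(a;q)_m=(1-a)(1-aq)\cdots(1-aq^{m-1})$ (with $(a;q)_0=1$); the $q$-integer is $[m]_q=1+q+\cdots+q^{m-1}$; the $q$-binomial coefficient is ${m\brack k}_q=\frac{(q;q)_m}{(q;q)_k(q;q)_{m-k}}$ for $0\leqslant k\leqslant m$. For rational functions $A(q),B(q)$ and a polynomial $P(q)$, $A\equiv B \pmod{P}$ means that $A-B$ can be written as $P(q)U(q)/V(q)$ with $U,V$ polynomials and $V$ relatively prime to $P$. *)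

theory Defs
  imports "HOL-Computational_Algebra.Computational_Algebra"
begin

definition q_shifted_factorial :: "'a::comm_ring_1 \<Rightarrow> 'a \<Rightarrow> nat \<Rightarrow> 'a" where
  "q_shifted_factorial a q m = (\<Prod>i<m. 1 - a * q ^ i)"

definition q_integer :: "'a::comm_ring_1 \<Rightarrow> nat \<Rightarrow> 'a" where
  "q_integer q m = (\<Sum>i<m. q ^ i)"

(* Only meaningful for k \<le> m and q not a root of unity. *)
definition q_binomial :: "'a::field \<Rightarrow> nat \<Rightarrow> nat \<Rightarrow> 'a" where
  "q_binomial q m k =
     q_shifted_factorial q q m / (q_shifted_factorial q q k * q_shifted_factorial q q (m - k))"

(* Rational functions over the rationals: the field of fractions of rat poly. *)
definition qvar :: "rat poly fract" where
  "qvar = to_fract [:0, 1:]"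

(* Congruence of rational functions modulo a polynomial. The modulus is passed as a rational
   function, because products of q-binomial coefficients arise as quotients; that it lies in
   the polynomial ring is part of the relation. *)
definition ratfun_cong ::
    "rat poly fract \<Rightarrow> rat poly fract \<Rightarrow> rat poly fract \<Rightarrow> bool" where
  "ratfun_cong A B M \<longleftrightarrow>
     (\<exists>P U V. M = to_fract P \<and> V \<noteq> 0 \<and> coprime V P \<and>
        A - B = to_fract P * to_fract U / to_fract V)"

end

theory Submission
  imports Defs
begin

text \<open>Put \<open>a = q\<^sup>2\<close>. Up to factors free of \<open>k\<close>, the \<open>k\<close>-th summand is a power of
  \<open>(a; a\<^sup>2)\<^sub>k / (a\<^sup>2; a\<^sup>2)\<^sub>k\<close> times a signed power of \<open>q\<close> and a \<open>q\<close>-integer part. The polynomial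
  \<open>N = [n]\<^sub>a\<close> times \<open>(2 n - 1 choose n - 1)\<close> in base \<open>a\<close> has only simple roots: if \<open>a\<close> has
  multiplicative order \<open>d\<close>, then it is a root of \<open>N\<close> precisely when \<open>d > 1\<close> and \<open>2 v + 1 \<ge> d\<close>,
  where \<open>v\<close> is the remainder of \<open>n - 1\<close> modulo \<open>d\<close>. For even \<open>d\<close> every summand vanishes at such a
  root. For odd \<open>d = 2 h + 1\<close> the summands vanish unless \<open>k = u d + t\<close> with \<open>t \<le> h\<close>, and the
  involution sending \<open>t\<close> to \<open>h - t\<close> changes the sign of the remaining ones. Moreover
  \<open>(1 + a ^ (n - 1)) ^ (2 r - j)\<close> divides each summand, with \<open>j = 1\<close> for the first sum and \<open>j = 0\<close>
  for the second; as \<open>1 + a ^ (n - 1)\<close> is squarefree, this is one factor more than required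
  by the modulus \<open>(1 + a ^ (n - 1)) ^ (2 r - 2) N\<close>, multiplied by the denominator for the second sum,
  and takes care of the roots it shares with \<open>N\<close>. Divisibility is thus
  checked root by root over the complex numbers and then descends to the rationals.\<close>

section \<open>Gaussian binomial coefficients\<close>

text \<open>Summands and modulus are written once over general commutative rings and then moved
  between rational polynomials, their fractions, complex polynomials and point values.\<close>

locale comm_ring_1_hom =
  fixes h :: "'a::comm_ring_1 \<Rightarrow> 'b::comm_ring_1"
  assumes hom_one [simp]: "h 1 = 1"
    and hom_add [simp]: "h (a + b) = h a + h b"
    and hom_mult [simp]: "h (a * b) = h a * h b"
begin

lemma hom_zero [simp]: "h 0 = 0"
  using hom_add [of 0 0] by simp

lemma hom_uminus [simp]: "h (- a) = - h a"
  using hom_add [of a "- a"] by (simp add: eq_neg_iff_add_eq_0 add.commute)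

lemma hom_diff [simp]: "h (a - b) = h a - h b"
  using hom_add [of a "- b"] by simp

lemma hom_power [simp]: "h (a ^ m) = h a ^ m"
  by (induction m) simp_all

lemma hom_sum [simp]: "h (sum f A) = (\<Sum>i\<in>A. h (f i))"
  by (induction A rule: infinite_finite_induct) simp_all

lemma hom_prod [simp]: "h (prod f A) = (\<Prod>i\<in>A. h (f i))"
  by (induction A rule: infinite_finite_induct) simp_all

lemma hom_q_shifted_factorial [simp]:
  "h (q_shifted_factorial a q m) = q_shifted_factorial (h a) (h q) m"
  by (simp add: q_shifted_factorial_def)

lemma hom_q_integer [simp]: "h (q_integer q m) = q_integer (h q) m"
  by (simp add: q_integer_def)

end

lemma comm_ring_1_hom_poly: "comm_ring_1_hom (\<lambda>p. poly p a)"
  by unfold_locales simp_all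

lemma comm_ring_1_hom_to_fract: "comm_ring_1_hom (to_fract :: 'a::idom \<Rightarrow> 'a fract)"
  by unfold_locales simp_all

lemma comm_ring_1_hom_map_poly_of_rat:
  "comm_ring_1_hom (map_poly of_rat :: rat poly \<Rightarrow> 'a::field_char_0 poly)"
  by unfold_locales
    (simp_all add: poly_eq_iff coeff_map_poly coeff_mult of_rat_add of_rat_sum of_rat_mult)

lemma q_shifted_factorial_0 [simp]: "q_shifted_factorial a q 0 = 1"
  by (simp add: q_shifted_factorial_def)

lemma q_shifted_factorial_Suc:
  "q_shifted_factorial a q (Suc m) = q_shifted_factorial a q m * (1 - a * q ^ m)"
  by (simp add: q_shifted_factorial_def)

lemma q_shifted_factorial_Suc_shift:
  "q_shifted_factorial a q (Suc m) = (1 - a) * q_shifted_factorial (a * q) q m"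
  by (simp add: q_shifted_factorial_def prod.lessThan_Suc_shift mult.assoc
      del: prod.lessThan_Suc)

lemma q_integer_mult: "q_integer q m * (1 - q) = 1 - q ^ m"
  unfolding q_integer_def by (simp add: one_diff_power_eq mult.commute)

text \<open>The \<open>q\<close>-Pascal recursion avoids division, so the coefficient makes sense at
  roots of unity too and commutes with ring homomorphisms.\<close>

fun gauss_binomial :: "'a::comm_ring_1 \<Rightarrow> nat \<Rightarrow> nat \<Rightarrow> 'a" where
  "gauss_binomial q n 0 = 1"
| "gauss_binomial q 0 (Suc k) = 0"
| "gauss_binomial q (Suc n) (Suc k) =
     gauss_binomial q n k + q ^ Suc k * gauss_binomial q n (Suc k)"

lemma (in comm_ring_1_hom) hom_gauss_binomial [simp]:
  "h (gauss_binomial q n k) = gauss_binomial (h q) n k"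
  by (induction q n k rule: gauss_binomial.induct) simp_all

lemma gauss_binomial_eq_0: "n < k \<Longrightarrow> gauss_binomial q n k = 0"
  by (induction q n k rule: gauss_binomial.induct) auto

lemma gauss_binomial_self: "gauss_binomial q n n = 1"
  by (induction n) (simp_all add: gauss_binomial_eq_0)

lemma gauss_binomial_at_0: "k \<le> n \<Longrightarrow> gauss_binomial 0 n k = 1"
  by (induction "0 :: 'a" n k rule: gauss_binomial.induct) simp_all

text \<open>Pascal's rule yields the quotient formula, cleared of denominators, by splitting 1 -
  q^(k+l+2) as (1 - q^(k+1)) + q^(k+1) (1 - q^(l+1)).\<close>

lemma gauss_binomial_mult_q_shifted_factorials:
  "gauss_binomial q (k + l) k * q_shifted_factorial q q k * q_shifted_factorial q q l
     = q_shifted_factorial q q (k + l)"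
proof (induction k arbitrary: l)
  case 0
  show ?case by simp
next
  case (Suc k)
  note outer = Suc.IH
  show ?case
  proof (induction l)
    case 0
    show ?case by (simp add: gauss_binomial_self)
  next
    case (Suc l)
    let ?p = "q_shifted_factorial q q"
    have 1: "gauss_binomial q (Suc (k + l)) k * ?p k * (?p l * (1 - q * q ^ l)) = ?p (Suc (k + l))"
      using outer [of "Suc l"] by (simp add: q_shifted_factorial_Suc)
    have 2: "gauss_binomial q (Suc (k + l)) (Suc k) * (?p k * (1 - q * q ^ k)) * ?p l
        = ?p (Suc (k + l))"
      using Suc.IH by (simp add: q_shifted_factorial_Suc)
    have "gauss_binomial q (Suc k + Suc l) (Suc k) * ?p (Suc k) * ?p (Suc l)
        = (1 - q ^ Suc k) * (gauss_binomial q (Suc (k + l)) k * ?p k * (?p l * (1 - q * q ^ l)))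
        + q ^ Suc k * (1 - q ^ Suc l)
            * (gauss_binomial q (Suc (k + l)) (Suc k) * (?p k * (1 - q * q ^ k)) * ?p l)"
      by (simp add: q_shifted_factorial_Suc algebra_simps)
    also have "\<dots> = ?p (Suc (k + l)) * (1 - q * q ^ Suc (k + l))"
      unfolding 1 2 by (simp add: algebra_simps power_add)
    finally show ?case by (simp add: q_shifted_factorial_Suc)
  qed
qed

lemma q_shifted_factorial_nonzero:
  fixes q :: "'a::idom"
  assumes "\<And>i. 0 < i \<Longrightarrow> i \<le> m \<Longrightarrow> q ^ i \<noteq> 1"
  shows "q_shifted_factorial q q m \<noteq> 0"
proof -
  have "1 - q * q ^ i \<noteq> 0" if "i < m" for i
    using assms [of "Suc i"] that by simp
  then show ?thesis by (simp add: q_shifted_factorial_def)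
qed

lemma gauss_binomial_eq_q_binomial:
  fixes q :: "'a::field"
  assumes "\<And>i. 0 < i \<Longrightarrow> q ^ i \<noteq> 1" and "k \<le> m"
  shows "gauss_binomial q m k = q_binomial q m k"
  using gauss_binomial_mult_q_shifted_factorials [of q k "m - k"]
    q_shifted_factorial_nonzero [of _ q] assms
  by (simp add: q_binomial_def field_simps)

lemma pCons_0_1_power_ne_1:
  assumes "0 < i" shows "[:0, 1::'a::idom:] ^ i \<noteq> 1"
proof
  assume "[:0, 1::'a:] ^ i = 1"
  then have "poly ([:0, 1::'a:] ^ i) 0 = 1" by simp
  with assms show False by (simp add: power_0_left)
qed

lemma pCons_0_1_square_power_ne_1:
  assumes "0 < i" shows "([:0, 1::'a::idom:]\<^sup>2) ^ i \<noteq> 1"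
  using pCons_0_1_power_ne_1 [of "2 * i"] assms by (simp only: power_mult [symmetric]) simp

text \<open>Dividing out the shifted factorials needs a base that is not a root of unity; the
  polynomial variable is one, and evaluating at \<open>x\<close> then covers all bases.\<close>

lemma gauss_binomial_central_Suc:
  fixes x :: "'a::idom"
  shows "gauss_binomial x (2 * Suc k) (Suc k) = (1 + x ^ Suc k) * gauss_binomial x (2 * k + 1) k"
proof -
  let ?X = "[:0, 1::'a:]"
  let ?p = "q_shifted_factorial ?X ?X"
  interpret comm_ring_1_hom "\<lambda>p. poly p x" by (rule comm_ring_1_hom_poly)
  have nz: "?p m \<noteq> 0" for m
    by (intro q_shifted_factorial_nonzero pCons_0_1_power_ne_1)
  have 1: "gauss_binomial ?X (2 * Suc k) (Suc k) * ?p (Suc k) * ?p (Suc k)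
      = ?p (2 * k + 1) * (1 - ?X * ?X ^ (2 * k + 1))"
    using gauss_binomial_mult_q_shifted_factorials [of ?X "Suc k" "Suc k"]
    by (simp add: q_shifted_factorial_Suc mult_2)
  have 2: "gauss_binomial ?X (2 * k + 1) k * ?p k * ?p (Suc k) = ?p (2 * k + 1)"
    using gauss_binomial_mult_q_shifted_factorials [of ?X k "Suc k"]
    by (simp add: mult_2)
  have 3: "1 - ?X * ?X ^ (2 * k + 1) = (1 - ?X * ?X ^ k) * (1 + ?X ^ Suc k)"
    by (simp add: algebra_simps mult_2 mult_2_right del: mult_pCons_left mult_pCons_right
        flip: power_add)
  have "gauss_binomial ?X (2 * Suc k) (Suc k) * (?p (Suc k) * ?p (Suc k))
      = (1 + ?X ^ Suc k) * gauss_binomial ?X (2 * k + 1) k * (?p (Suc k) * ?p (Suc k))"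
    using 1 unfolding 3 2 [symmetric] by (simp add: q_shifted_factorial_Suc mult_ac)
  then have "gauss_binomial ?X (2 * Suc k) (Suc k) = (1 + ?X ^ Suc k) * gauss_binomial ?X (2 * k + 1) k"
    using nz [of "Suc k"] by (metis mult_cancel_right mult_eq_0_iff)
  then have "poly (gauss_binomial ?X (2 * Suc k) (Suc k)) x
      = poly ((1 + ?X ^ Suc k) * gauss_binomial ?X (2 * k + 1) k) x" by (rule arg_cong)
  then show ?thesis by (simp del: gauss_binomial.simps)
qed

text \<open>Together with \<open>gauss_binomial_central_Suc\<close> this gives the ratio of
  consecutive central coefficients.\<close>

lemma gauss_binomial_odd_central:
  fixes x :: "'a::idom"
  shows "(1 - x ^ Suc k) * gauss_binomial x (2 * k + 1) k
    = (1 - x ^ (2 * k + 1)) * gauss_binomial x (2 * k) k"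
proof -
  let ?X = "[:0, 1::'a:]"
  let ?p = "q_shifted_factorial ?X ?X"
  interpret comm_ring_1_hom "\<lambda>p. poly p x" by (rule comm_ring_1_hom_poly)
  have nz: "?p m \<noteq> 0" for m
    by (intro q_shifted_factorial_nonzero pCons_0_1_power_ne_1)
  have 1: "gauss_binomial ?X (2 * k) k * ?p k * ?p k = ?p (2 * k)"
    using gauss_binomial_mult_q_shifted_factorials [of ?X k k] by (simp add: mult_2)
  have 2: "gauss_binomial ?X (2 * k + 1) k * ?p k * (?p k * (1 - ?X ^ Suc k))
      = ?p (2 * k) * (1 - ?X ^ (2 * k + 1))"
    using gauss_binomial_mult_q_shifted_factorials [of ?X k "Suc k"]
    by (simp add: q_shifted_factorial_Suc mult_2)
  have "(1 - ?X ^ Suc k) * gauss_binomial ?X (2 * k + 1) k * (?p k * ?p k)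
      = (1 - ?X ^ (2 * k + 1)) * gauss_binomial ?X (2 * k) k * (?p k * ?p k)"
    using 2 unfolding 1 [symmetric] by (simp only: mult_ac)
  then have "(1 - ?X ^ Suc k) * gauss_binomial ?X (2 * k + 1) k
      = (1 - ?X ^ (2 * k + 1)) * gauss_binomial ?X (2 * k) k"
    using nz [of k] by (metis mult_cancel_right mult_eq_0_iff)
  then have "poly ((1 - ?X ^ Suc k) * gauss_binomial ?X (2 * k + 1) k) x
      = poly ((1 - ?X ^ (2 * k + 1)) * gauss_binomial ?X (2 * k) k) x" by (rule arg_cong)
  then show ?thesis by simp
qed

section \<open>The summands\<close>

text \<open>The binomial occurs to the power 2 r - j and the shifted factorial to twice that power,
  so both sums are built from this one product. Its shifted factorial is the product of 1 + a^i over
  k < i < n.\<close>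

definition central_term :: "'a::comm_ring_1 \<Rightarrow> nat \<Rightarrow> nat \<Rightarrow> 'a" where
  "central_term a n k =
     gauss_binomial a (2 * k) k * q_shifted_factorial (- (a ^ Suc k)) a (n - k - 1) ^ 2"

text \<open>The first sum is j = 1, the second j = 0. The exponent of \<open>q\<close> is the
  original one raised by (4 s + 4) n, which makes it a natural number for k \<le> n.\<close>

definition summand :: "'a::comm_ring_1 \<Rightarrow> nat \<Rightarrow> nat \<Rightarrow> nat \<Rightarrow> nat \<Rightarrow> nat \<Rightarrow> 'a" where
  "summand q n r s j k =
     (-1) ^ (j * k) * q ^ (2 * j * k\<^sup>2 + 2 * r * k + (4 * s + 4) * (n - k))
     * q_integer q (4 * k + 1) ^ (2 * s) * q_integer (q\<^sup>2) (4 * k + 1)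
     * central_term (q\<^sup>2) n k ^ (2 * r - j)"

lemma (in comm_ring_1_hom) hom_summand [simp]:
  "h (summand q n r s j k) = summand (h q) n r s j k"
  by (simp add: summand_def central_term_def)

text \<open>For k < m the shifted factorial contains the factor 1 + a^m; for k = m > 0 the central
  coefficient does.\<close>

lemma central_term_eq_0:
  assumes "k \<le> m" "k < m \<or> 0 < k" "m < n" "a ^ m = (-1 :: 'a :: idom)"
  shows "central_term a n k = 0"
proof (cases "k < m")
  case True
  have "1 - (- (a ^ Suc k)) * a ^ (m - k - 1) = 1 + a ^ (Suc k + (m - k - 1))"
    by (simp add: power_add)
  also have "Suc k + (m - k - 1) = m" using True by simp
  finally have "\<exists>i<n - k - 1. 1 - (- (a ^ Suc k)) * a ^ i = 0"
    using assms True by (intro exI [of _ "m - k - 1"]) simp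
  then have "q_shifted_factorial (- (a ^ Suc k)) a (n - k - 1) = 0"
    unfolding q_shifted_factorial_def by (auto intro: prod_zero)
  then show ?thesis by (simp add: central_term_def)
next
  case False
  with assms obtain i where "k = Suc i" "k = m" by (cases k) auto
  with assms gauss_binomial_central_Suc [of a i] show ?thesis
    by (simp add: central_term_def del: gauss_binomial.simps mult_Suc_right)
qed

text \<open>The last factor of the shifted factorial is 1 + a^(n-1). At k = n - 1 that product is
  empty, and the central coefficient supplies the factor because n - 1 > 0.\<close>

lemma one_plus_power_dvd_central_term:
  assumes "k < n" "2 \<le> n"
  shows "1 + a ^ (n - 1) dvd central_term (a :: 'a :: idom) n k"
proof (cases "k < n - 1")
  case True
  have "1 - (- (a ^ Suc k)) * a ^ (n - k - 2) = 1 + a ^ (Suc k + (n - k - 2))"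
    by (simp add: power_add)
  also have "Suc k + (n - k - 2) = n - 1" using True by simp
  finally have "1 - (- (a ^ Suc k)) * a ^ (n - k - 2) = 1 + a ^ (n - 1)" .
  moreover have "1 - (- (a ^ Suc k)) * a ^ (n - k - 2)
      dvd q_shifted_factorial (- (a ^ Suc k)) a (n - k - 1)"
    unfolding q_shifted_factorial_def using True by (intro dvd_prodI) auto
  ultimately show ?thesis by (simp add: central_term_def power2_eq_square)
next
  case False
  with assms obtain i where "k = Suc i" "k = n - 1" by (cases k) auto
  with gauss_binomial_central_Suc [of a i] show ?thesis
    by (simp add: central_term_def del: gauss_binomial.simps mult_Suc_right)
qed

text \<open>Passing to k + 1 drops (1 + a^(k+1))^2 from the product and multiplies the coefficient
  by (1 + a^(k+1)) (1 - a^(2k+1)) / (1 - a^(k+1)). Denominators are cleared as they may vanish at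
  roots of unity.\<close>

lemma central_term_Suc:
  fixes a :: "'a::idom"
  assumes "Suc k < n"
  shows "central_term a n (Suc k) * (1 - a ^ (2 * k + 2)) = central_term a n k * (1 - a ^ (2 * k + 1))"
proof -
  let ?G = "\<lambda>k. gauss_binomial a (2 * k) k"
  define D where "D k = q_shifted_factorial (- (a ^ Suc k)) a (n - k - 1)" for k
  have D: "D k = (1 + a ^ Suc k) * D (Suc k)"
  proof -
    have "n - k - 1 = Suc (n - Suc k - 1)" using assms by simp
    then show ?thesis
      unfolding D_def by (simp add: q_shifted_factorial_Suc_shift mult.commute)
  qed
  have G: "(1 - a ^ Suc k) * ?G (Suc k) = (1 + a ^ Suc k) * (1 - a ^ (2 * k + 1)) * ?G k"
  proof -
    have "(1 - a ^ Suc k) * ?G (Suc k)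
        = (1 + a ^ Suc k) * ((1 - a ^ Suc k) * gauss_binomial a (2 * k + 1) k)"
      unfolding gauss_binomial_central_Suc by (simp only: mult_ac)
    then show ?thesis unfolding gauss_binomial_odd_central by (simp only: mult.assoc)
  qed
  have "1 - a ^ (2 * k + 2) = (1 + a ^ Suc k) * (1 - a ^ Suc k)"
    by (simp add: algebra_simps mult_2 mult_2_right flip: power_add)
  then have "?G (Suc k) * D (Suc k) ^ 2 * (1 - a ^ (2 * k + 2))
      = ((1 - a ^ Suc k) * ?G (Suc k)) * (1 + a ^ Suc k) * D (Suc k) ^ 2"
    by (simp only: mult_ac)
  also have "\<dots> = ?G k * D k ^ 2 * (1 - a ^ (2 * k + 1))"
    unfolding G D by (simp only: mult_ac power2_eq_square)
  finally show ?thesis by (simp only: central_term_def D_def)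
qed

section \<open>Blocks of one period and the half-period reflection\<close>

lemma square_power_shift:
  fixes a :: "'a::comm_ring_1"
  shows "a\<^sup>2 * (a\<^sup>2) ^ t = a ^ (2 * t + 2)" "a * (a\<^sup>2) ^ t = a ^ (2 * t + 1)"
  by (simp_all only: power_add power_mult power_one_right mult.commute [of "a\<^sup>2"] mult.commute [of a])

text \<open>Within a block of length equal to the order of \<open>a\<close>, the central term behaves like
  \<open>(a; a\<^sup>2)\<^sub>t / (a\<^sup>2; a\<^sup>2)\<^sub>t\<close>, whatever the block.\<close>

lemma central_term_block:
  fixes a :: "'a::idom"
  assumes "a ^ d = 1" "u * d + t < n"
  shows "central_term a n (u * d + t) * q_shifted_factorial (a\<^sup>2) (a\<^sup>2) t
    = central_term a n (u * d) * q_shifted_factorial a (a\<^sup>2) t"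
  using assms(2)
proof (induction t)
  case 0
  show ?case by simp
next
  case (Suc t)
  \<comment> \<open>Powers of \<open>a\<close> see exponents only modulo d, so the ratio at u d + t
    equals the one at t.\<close>
  have per: "a ^ (2 * (u * d + t) + i) = a ^ (2 * t + i)" for i
  proof -
    have "2 * (u * d + t) + i = d * (2 * u) + (2 * t + i)" by (simp add: algebra_simps)
    then show ?thesis by (simp only: power_add power_mult assms(1) power_one mult_1)
  qed
  have 2: "central_term a n (u * d + Suc t) * (1 - a ^ (2 * t + 2))
      = central_term a n (u * d + t) * (1 - a ^ (2 * t + 1))"
    using central_term_Suc [of "u * d + t" n a] Suc.prems unfolding per by simp
  have IH: "central_term a n (u * d + t) * q_shifted_factorial (a\<^sup>2) (a\<^sup>2) t
    = central_term a n (u * d) * q_shifted_factorial a (a\<^sup>2) t"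
    using Suc by simp
  have "central_term a n (u * d + Suc t) * q_shifted_factorial (a\<^sup>2) (a\<^sup>2) (Suc t)
      = (central_term a n (u * d + Suc t) * (1 - a ^ (2 * t + 2)))
        * q_shifted_factorial (a\<^sup>2) (a\<^sup>2) t"
    by (simp only: q_shifted_factorial_Suc square_power_shift mult_ac)
  also have "\<dots> = (central_term a n (u * d + t) * q_shifted_factorial (a\<^sup>2) (a\<^sup>2) t)
        * (1 - a ^ (2 * t + 1))"
    unfolding 2 by (simp only: mult_ac)
  also have "\<dots> = central_term a n (u * d) * q_shifted_factorial a (a\<^sup>2) (Suc t)"
    unfolding IH by (simp only: q_shifted_factorial_Suc square_power_shift mult_ac)
  finally show ?case .
qed

text \<open>As a^(2h+1) = 1, multiplying 1 - a^(2(h-i)-1) by a^(2i+2) gives -(1 - a^(2i+2)).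
  Reversing the odd product therefore matches it with the even one; the powers used multiply to
  a^(h(h+1)).\<close>

lemma q_shifted_factorial_half:
  fixes a :: "'a::comm_ring_1"
  assumes "a ^ (2 * h + 1) = 1"
  shows "a ^ (h * (h + 1)) * q_shifted_factorial a (a\<^sup>2) h
    = (-1) ^ h * q_shifted_factorial (a\<^sup>2) (a\<^sup>2) h"
proof -
  have 0: "(\<Prod>i<m. a ^ (2 * i + 2)) = a ^ (m * (m + 1))" for m
  proof (induction m)
    case (Suc m)
    have "m * (m + 1) + (2 * m + 2) = Suc m * (Suc m + 1)" by simp
    with Suc show ?case by (simp only: prod.lessThan_Suc flip: power_add)
  qed simp
  have 1: "q_shifted_factorial a (a\<^sup>2) h = (\<Prod>i<h. 1 - a * (a\<^sup>2) ^ (h - Suc i))"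
    unfolding q_shifted_factorial_def by (rule prod.nat_diff_reindex [symmetric])
  have "a ^ (2 * i + 2) * (1 - a * (a\<^sup>2) ^ (h - Suc i)) = - (1 - a\<^sup>2 * (a\<^sup>2) ^ i)" if "i < h" for i
  proof -
    have "a ^ (2 * i + 2) * (a * (a\<^sup>2) ^ (h - Suc i)) = a ^ (2 * i + 2 + (1 + 2 * (h - Suc i)))"
      by (simp only: power_add power_mult power_one_right)
    also have "2 * i + 2 + (1 + 2 * (h - Suc i)) = 2 * h + 1" using that by simp
    finally have "a ^ (2 * i + 2) * (a * (a\<^sup>2) ^ (h - Suc i)) = 1" using assms by simp
    then show ?thesis by (simp only: right_diff_distrib square_power_shift) simp
  qed
  then have "(\<Prod>i<h. a ^ (2 * i + 2) * (1 - a * (a\<^sup>2) ^ (h - Suc i)))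
      = (\<Prod>i<h. (-1) * (1 - a\<^sup>2 * (a\<^sup>2) ^ i))"
    by (intro prod.cong) simp_all
  then show ?thesis
    unfolding 1 by (simp only: prod.distrib 0 prod_constant card_lessThan q_shifted_factorial_def)
qed

text \<open>With c(t) = (a; a^2)_t / (a^2; a^2)_t this is a^(h(h+1)) c(h-t) = (-1)^h a^t c(t),
  cleared of denominators. Induction on t moves one factor at a time across the reflection.\<close>

lemma q_shifted_factorial_reflect:
  fixes a :: "'a::comm_ring_1"
  assumes "a ^ (2 * h + 1) = 1" "t \<le> h"
  shows "a ^ (h * (h + 1)) * q_shifted_factorial a (a\<^sup>2) (h - t) * q_shifted_factorial (a\<^sup>2) (a\<^sup>2) t
    = (-1) ^ h * a ^ t * q_shifted_factorial a (a\<^sup>2) t * q_shifted_factorial (a\<^sup>2) (a\<^sup>2) (h - t)"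
  using assms(2)
proof (induction t)
  case 0
  show ?case using q_shifted_factorial_half [OF assms(1)] by simp
next
  case (Suc t)
  define N where "N = q_shifted_factorial a (a\<^sup>2)"
  define M where "M = q_shifted_factorial (a\<^sup>2) (a\<^sup>2)"
  let ?p = "h - Suc t"
  have p: "h - t = Suc ?p" using Suc.prems by simp
  have N: "N (Suc i) = N i * (1 - a ^ (2 * i + 1))" and M: "M (Suc i) = M i * (1 - a ^ (2 * i + 2))" for i
    by (simp_all only: N_def M_def q_shifted_factorial_Suc square_power_shift)
  \<comment> \<open>On each side, the exponents of the factor lost and the factor gained add up to 2
    h + 1.\<close>
  have wrap: "a ^ (2 * t + 2) * a ^ (2 * ?p + 1) = 1" "a ^ (2 * t + 1) * a ^ (2 * ?p + 2) = 1"
  proof -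
    have "2 * t + 2 + (2 * ?p + 1) = 2 * h + 1" "2 * t + 1 + (2 * ?p + 2) = 2 * h + 1"
      using Suc.prems by simp_all
    then show "a ^ (2 * t + 2) * a ^ (2 * ?p + 1) = 1" "a ^ (2 * t + 1) * a ^ (2 * ?p + 2) = 1"
      using assms(1) by (metis power_add)+
  qed
  have 1: "a ^ (2 * t + 2) * (1 - a ^ (2 * ?p + 1)) = - (1 - a ^ (2 * t + 2))"
    and 2: "a ^ (2 * t + 1) * (1 - a ^ (2 * ?p + 2)) = - (1 - a ^ (2 * t + 1))"
    using wrap by (simp_all add: right_diff_distrib del: power_Suc)
  have IH: "a ^ (h * (h + 1)) * N (Suc ?p) * M t = (-1) ^ h * a ^ t * N t * M (Suc ?p)"
    using Suc p by (simp add: N_def M_def)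
  have "a ^ (h * (h + 1)) * N ?p * M (Suc t)
      = a ^ (h * (h + 1)) * N ?p * M t * (1 - a ^ (2 * t + 2))"
    unfolding M by (simp only: mult_ac)
  also have "1 - a ^ (2 * t + 2) = - (a ^ (2 * t + 2) * (1 - a ^ (2 * ?p + 1)))"
    unfolding 1 by simp
  also have "a ^ (h * (h + 1)) * N ?p * M t * (- (a ^ (2 * t + 2) * (1 - a ^ (2 * ?p + 1))))
      = - (a ^ (2 * t + 2) * (a ^ (h * (h + 1)) * N (Suc ?p) * M t))"
    unfolding N by (simp only: mult_ac mult_minus_right)
  also have "\<dots> = (-1) ^ h * (a * a ^ t) * N t * M ?p
      * (- (a ^ (2 * t + 1) * (1 - a ^ (2 * ?p + 2))))"
    unfolding IH M by (simp add: mult_ac)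
  also have "\<dots> = (-1) ^ h * a ^ Suc t * N (Suc t) * M ?p"
    unfolding 2 N by (simp add: mult_ac)
  finally show ?case by (simp only: N_def M_def)
qed

section \<open>Vanishing at roots of unity\<close>

text \<open>Both terms are the value at the start of the block times c(h-t) or c(t), so the
  reflection of c carries over; \<open>prim\<close> makes the even products cancellable.\<close>

lemma central_term_reflect:
  fixes a :: "'a::idom"
  assumes root: "a ^ (2 * h + 1) = 1" and "t \<le> h" and lt: "u * (2 * h + 1) + h < n"
    and prim: "\<And>i. 0 < i \<Longrightarrow> i \<le> h \<Longrightarrow> (a\<^sup>2) ^ i \<noteq> 1"
  shows "a ^ (h * (h + 1)) * central_term a n (u * (2 * h + 1) + (h - t))
    = (-1) ^ h * a ^ t * central_term a n (u * (2 * h + 1) + t)"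
proof -
  let ?k = "u * (2 * h + 1)"
  define N where "N = q_shifted_factorial a (a\<^sup>2)"
  define M where "M = q_shifted_factorial (a\<^sup>2) (a\<^sup>2)"
  have M0: "M i \<noteq> 0" if "i \<le> h" for i
    unfolding M_def using that by (intro q_shifted_factorial_nonzero prim) simp_all
  have block: "central_term a n (?k + i) * M i = central_term a n ?k * N i" if "i \<le> h" for i
    unfolding M_def N_def using that lt by (intro central_term_block root) simp
  have refl: "a ^ (h * (h + 1)) * N (h - t) * M t = (-1) ^ h * a ^ t * N t * M (h - t)"
    unfolding N_def M_def by (intro q_shifted_factorial_reflect assms)
  have "a ^ (h * (h + 1)) * central_term a n (?k + (h - t)) * (M (h - t) * M t)
      = a ^ (h * (h + 1)) * (central_term a n (?k + (h - t)) * M (h - t)) * M t"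
    by (simp only: mult_ac)
  also have "\<dots> = central_term a n ?k * (a ^ (h * (h + 1)) * N (h - t) * M t)"
    using block [of "h - t"] by simp
  also have "\<dots> = (-1) ^ h * a ^ t * (central_term a n ?k * N t) * M (h - t)"
    unfolding refl by (simp only: mult_ac)
  also have "\<dots> = (-1) ^ h * a ^ t * central_term a n (?k + t) * (M (h - t) * M t)"
    unfolding block [OF \<open>t \<le> h\<close>, symmetric] by (simp only: mult_ac)
  finally show ?thesis using M0 [of t] M0 [of "h - t"] \<open>t \<le> h\<close> by simp
qed

lemma power_mod_period:
  fixes a :: "'a::comm_ring_1"
  assumes "a ^ d = 1" "i = d * m + j"
  shows "a ^ i = a ^ j"
  using assms by (simp add: power_add power_mult)

text \<open>Squaring the reflection removes the sign, and 2 h (h + 1) is h modulo 2 h + 1. The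
  invariant weight found here occurs r - j times in a summand.\<close>

lemma central_term_reflect_square:
  fixes a :: "'a::idom"
  assumes root: "a ^ (2 * h + 1) = 1" and "t \<le> h" and lt: "u * (2 * h + 1) + h < n"
    and prim: "\<And>i. 0 < i \<Longrightarrow> i \<le> h \<Longrightarrow> (a\<^sup>2) ^ i \<noteq> 1"
  defines "k \<equiv> u * (2 * h + 1) + t" and "k' \<equiv> u * (2 * h + 1) + (h - t)"
  shows "a ^ k' * central_term a n k' ^ 2 = a ^ k * central_term a n k ^ 2"
proof -
  have a0: "a \<noteq> 0" using root by (auto simp: power_0_left)
  have "a ^ (h * (h + 1)) * central_term a n k' = (-1) ^ h * a ^ t * central_term a n k"
    unfolding k_def k'_def by (intro central_term_reflect assms)
  then have "(a ^ (h * (h + 1)) * central_term a n k')\<^sup>2 = ((-1) ^ h * a ^ t * central_term a n k)\<^sup>2"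
    by simp
  then have "a ^ (h * (h + 1) * 2) * central_term a n k' ^ 2 = a ^ (t * 2) * central_term a n k ^ 2"
    by (simp add: power_mult_distrib power_mult [symmetric])
  moreover have "a ^ (h * (h + 1) * 2) = a ^ h"
    by (rule power_mod_period [OF root, of _ h]) (simp add: algebra_simps)
  moreover have "a ^ (t + k') = a ^ h"
    by (rule power_mod_period [OF root, of _ u]) (use \<open>t \<le> h\<close> in \<open>simp add: k'_def algebra_simps\<close>)
  moreover have "a ^ (t + k) = a ^ (t * 2)"
    by (rule power_mod_period [OF root, of _ u]) (simp add: k_def algebra_simps)
  ultimately have "a ^ t * (a ^ k' * central_term a n k' ^ 2) = a ^ t * (a ^ k * central_term a n k ^ 2)"
    by (simp add: power_add mult.assoc [symmetric])
  then show ?thesis using a0 by simp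
qed

text \<open>The sign and the quadratic power of \<open>a\<close> absorb the factors of the
  reflection, since k^2 + k modulo 2 h + 1 depends only on the position in the block. This weight
  occurs j times in a summand.\<close>

lemma central_term_reflect_signed:
  fixes a :: "'a::idom"
  assumes root: "a ^ (2 * h + 1) = 1" and "t \<le> h" and lt: "u * (2 * h + 1) + h < n"
    and prim: "\<And>i. 0 < i \<Longrightarrow> i \<le> h \<Longrightarrow> (a\<^sup>2) ^ i \<noteq> 1"
  defines "k \<equiv> u * (2 * h + 1) + t" and "k' \<equiv> u * (2 * h + 1) + (h - t)"
  shows "(-1) ^ k' * a ^ (k' * k' + k') * central_term a n k'
    = (-1) ^ k * a ^ (k * k + k) * central_term a n k"
proof -
  define p where "p = h - t"
  have h: "h = p + t" using \<open>t \<le> h\<close> by (simp add: p_def)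
  have per: "a ^ ((u * (2 * h + 1) + i) * (u * (2 * h + 1) + i) + (u * (2 * h + 1) + i)) = a ^ (i * i + i)" for i
    by (rule power_mod_period [OF root, of _ "u * (u * (2 * h + 1) + 2 * i + 1)"])
      (simp add: algebra_simps)
  have eq: "a ^ (h * (h + 1)) * central_term a n k' = (-1) ^ h * a ^ t * central_term a n k"
    unfolding k_def k'_def by (intro central_term_reflect assms)
  \<comment> \<open>With h = p + t the two exponents differ by t (2 h + 1).\<close>
  have "a ^ (h * (h + 1) + t * t) = a ^ (p * p + p)"
    by (rule power_mod_period [OF root, of _ t]) (simp add: h algebra_simps)
  then have "a ^ (k' * k' + k') = a ^ (t * t) * a ^ (h * (h + 1))"
    unfolding k'_def p_def [symmetric] per by (simp only: power_add mult.commute)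
  then have "(-1) ^ k' * a ^ (k' * k' + k') * central_term a n k'
      = (-1) ^ k' * a ^ (t * t) * (a ^ (h * (h + 1)) * central_term a n k')"
    by (simp only: mult_ac)
  also have "\<dots> = ((-1) ^ k' * (-1) ^ h) * a ^ (t * t + t) * central_term a n k"
    unfolding eq by (simp only: mult_ac power_add)
  also have "(-1) ^ k' * (-1) ^ h = ((-1) ^ k :: 'a)"
  proof -
    have "even (k' + h) \<longleftrightarrow> even k" unfolding k_def k'_def p_def [symmetric] h by auto
    then show ?thesis by (cases "even k") (simp_all del: even_add flip: power_add)
  qed
  finally show ?thesis unfolding k_def per .
qed

text \<open>Since 2 (n - k) + (4 k + 1) = 2 (k + k') + 1 + 2 (n - k'), the two terms of the
  difference for k are, up to \<sigma>, those for k' in opposite order.\<close>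

lemma power_reflect:
  fixes x :: "'a::comm_ring_1"
  assumes "x ^ (2 * (k + k') + 1) = \<sigma>" "\<sigma> * \<sigma> = 1" "k \<le> n" "k' \<le> n"
  shows "x ^ (2 * (n - k')) * (1 - x ^ (4 * k' + 1))
    = - \<sigma> * (x ^ (2 * (n - k)) * (1 - x ^ (4 * k + 1)))"
proof -
  have *: "x ^ (2 * (n - i)) * x ^ (4 * i + 1) = \<sigma> * x ^ (2 * (n - i'))"
    if "x ^ (2 * (i + i') + 1) = \<sigma>" "i \<le> n" "i' \<le> n" for i i'
  proof -
    have "2 * (n - i) + (4 * i + 1) = 2 * (i + i') + 1 + 2 * (n - i')" using that by simp
    then have "x ^ (2 * (n - i)) * x ^ (4 * i + 1) = x ^ (2 * (i + i') + 1) * x ^ (2 * (n - i'))"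
      by (metis power_add)
    then show ?thesis using that by simp
  qed
  have 1: "x ^ (2 * (n - k)) * x ^ (4 * k + 1) = \<sigma> * x ^ (2 * (n - k'))"
    by (rule *) (use assms in auto)
  have 2: "x ^ (2 * (n - k')) * x ^ (4 * k' + 1) = \<sigma> * x ^ (2 * (n - k))"
    by (rule *) (use assms in \<open>auto simp: add.commute\<close>)
  show ?thesis
    unfolding right_diff_distrib 1 2 using assms(2) by (simp add: algebra_simps flip: mult.assoc)
qed

text \<open>Clearing the denominators of the \<open>q\<close>-integers and distributing the power of
  \<open>q\<close> splits the summand into four groups, each with a known behaviour under
  reflection.\<close>

lemma summand_mult_denominators:
  fixes q :: "'a::comm_ring_1"
  assumes "j \<le> r"
  shows "summand q n r s j k * ((1 - q) ^ (2 * s) * (1 - q\<^sup>2))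
    = ((q\<^sup>2) ^ k * central_term (q\<^sup>2) n k ^ 2) ^ (r - j)
      * ((-1) ^ k * (q\<^sup>2) ^ (k * k + k) * central_term (q\<^sup>2) n k) ^ j
      * (q ^ (2 * (n - k)) * (1 - q ^ (4 * k + 1))) ^ (2 * s)
      * ((q\<^sup>2) ^ (2 * (n - k)) * (1 - (q\<^sup>2) ^ (4 * k + 1)))"
proof -
  let ?T = "central_term (q\<^sup>2) n k"
  have c: "2 * r - j = 2 * (r - j) + j" using assms by simp
  have e: "2 * j * k\<^sup>2 + 2 * r * k + (4 * s + 4) * (n - k)
      = 2 * (k * (r - j)) + 2 * ((k * k + k) * j) + 2 * (n - k) * (2 * s) + 2 * (2 * (n - k))"
  proof -
    obtain i where "r = j + i" using assms le_Suc_ex by blast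
    then show ?thesis by (simp add: algebra_simps power2_eq_square)
  qed
  have q: "q ^ (2 * j * k\<^sup>2 + 2 * r * k + (4 * s + 4) * (n - k))
      = ((q\<^sup>2) ^ k) ^ (r - j) * ((q\<^sup>2) ^ (k * k + k)) ^ j * (q ^ (2 * (n - k))) ^ (2 * s)
        * (q\<^sup>2) ^ (2 * (n - k))"
    unfolding e by (simp only: power_add power_mult)
  have T: "?T ^ (2 * r - j) = (?T ^ 2) ^ (r - j) * ?T ^ j"
    unfolding c by (simp only: power_add power_mult)
  have s: "(-1) ^ (j * k) = ((-1) ^ k :: 'a) ^ j"
    by (simp only: power_mult [symmetric] mult.commute)
  have "summand q n r s j k * ((1 - q) ^ (2 * s) * (1 - q\<^sup>2))
      = (-1) ^ (j * k) * q ^ (2 * j * k\<^sup>2 + 2 * r * k + (4 * s + 4) * (n - k))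
        * (q_integer q (4 * k + 1) * (1 - q)) ^ (2 * s)
        * (q_integer (q\<^sup>2) (4 * k + 1) * (1 - q\<^sup>2)) * ?T ^ (2 * r - j)"
    unfolding summand_def power_mult_distrib by (simp only: mult_ac)
  then show ?thesis
    unfolding q_integer_mult q T s power_mult_distrib by (simp only: mult_ac)
qed

text \<open>The two groups of central terms are invariant, the group with exponent 2 s is invariant
  because that exponent is even, and the last factor changes sign.\<close>

lemma summand_reflect:
  fixes q :: "'a::idom"
  assumes root: "(q\<^sup>2) ^ (2 * h + 1) = 1" and "0 < h" "t \<le> h" and lt: "u * (2 * h + 1) + h < n"
    and prim: "\<And>i. 0 < i \<Longrightarrow> i \<le> h \<Longrightarrow> ((q\<^sup>2)\<^sup>2) ^ i \<noteq> 1" and "j \<le> r"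
  defines "k \<equiv> u * (2 * h + 1) + t" and "k' \<equiv> u * (2 * h + 1) + (h - t)"
  shows "summand q n r s j k' = - summand q n r s j k"
proof -
  define a where "a = q\<^sup>2"
  \<comment> \<open>The case i = 1 of \<open>prim\<close> excludes q^2 = 1, so the cleared
    denominators are nonzero.\<close>
  have "(a\<^sup>2) ^ 1 \<noteq> 1" unfolding a_def by (rule prim) (use \<open>0 < h\<close> in simp_all)
  then have "a \<noteq> 1" by auto
  then have nz: "(1 - q) ^ (2 * s) * (1 - q\<^sup>2) \<noteq> 0" by (auto simp: a_def)
  have bounds: "k \<le> n" "k' \<le> n" using lt \<open>t \<le> h\<close> by (simp_all add: k_def k'_def)
  have kk: "2 * (k + k') + 1 = (2 * h + 1) * (4 * u + 1)"
    using \<open>t \<le> h\<close> by (simp add: k_def k'_def algebra_simps)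
  \<comment> \<open>The root condition concerns q^2 only, so \<sigma> may be -1; what matters is
    that its square is 1.\<close>
  define \<sigma> where "\<sigma> = q ^ (2 * (k + k') + 1)"
  have a1: "a ^ (2 * (k + k') + 1) = 1"
    unfolding kk using root by (simp only: power_mult a_def power_one)
  moreover have "\<sigma> * \<sigma> = a ^ (2 * (k + k') + 1)"
    unfolding \<sigma>_def a_def by (simp only: power_mult [symmetric] power_mult_distrib [symmetric] power2_eq_square)
  ultimately have \<sigma>: "\<sigma> * \<sigma> = 1" by simp
  have "q ^ (2 * (n - k')) * (1 - q ^ (4 * k' + 1)) = - \<sigma> * (q ^ (2 * (n - k)) * (1 - q ^ (4 * k + 1)))"
    by (rule power_reflect) (use \<sigma> bounds in \<open>simp_all add: \<sigma>_def\<close>)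
  moreover have "(- \<sigma> * y) ^ (2 * s) = y ^ (2 * s)" for y
  proof -
    have "(- \<sigma> * y)\<^sup>2 = (\<sigma> * \<sigma>) * y\<^sup>2" by (simp add: power2_eq_square mult_ac)
    then show ?thesis unfolding power_mult \<sigma> by simp
  qed
  ultimately have 1: "(q ^ (2 * (n - k')) * (1 - q ^ (4 * k' + 1))) ^ (2 * s)
      = (q ^ (2 * (n - k)) * (1 - q ^ (4 * k + 1))) ^ (2 * s)"
    by (simp only:)
  have 2: "a ^ (2 * (n - k')) * (1 - a ^ (4 * k' + 1)) = - 1 * (a ^ (2 * (n - k)) * (1 - a ^ (4 * k + 1)))"
    by (rule power_reflect) (use a1 bounds in simp_all)
  have 3: "a ^ k' * central_term a n k' ^ 2 = a ^ k * central_term a n k ^ 2"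
    unfolding k_def k'_def a_def by (intro central_term_reflect_square assms)
  have 4: "(-1) ^ k' * a ^ (k' * k' + k') * central_term a n k'
      = (-1) ^ k * a ^ (k * k + k) * central_term a n k"
    unfolding k_def k'_def a_def by (intro central_term_reflect_signed assms)
  have "summand q n r s j k' * ((1 - q) ^ (2 * s) * (1 - q\<^sup>2))
      = - summand q n r s j k * ((1 - q) ^ (2 * s) * (1 - q\<^sup>2))"
    unfolding mult_minus_left summand_mult_denominators [OF \<open>j \<le> r\<close>] 1
      2 [unfolded a_def] 3 [unfolded a_def] 4 [unfolded a_def]
    by (simp only: mult_minus_left mult_minus_right mult_1)
  then show ?thesis using nz by (metis mult_right_cancel)
qed

text \<open>The sum over the indices with remainder at most h equals its own negative under \<tau>,
  hence is 0 in characteristic zero. All other summands vanish one by one.\<close>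

lemma sum_summand_eq_0_odd:
  fixes q :: "'a::{idom,ring_char_0}"
  assumes root: "(q\<^sup>2) ^ (2 * h + 1) = 1" and "0 < h" and le: "h \<le> (n - 1) mod (2 * h + 1)"
    and prim: "\<And>i. 0 < i \<Longrightarrow> i < 2 * h + 1 \<Longrightarrow> ((q\<^sup>2)\<^sup>2) ^ i \<noteq> 1" and "j \<le> r" "1 \<le> r"
  shows "(\<Sum>k<n. summand q n r s j k) = 0"
proof -
  define d where "d = 2 * h + 1"
  let ?f = "summand q n r s j"
  define A where "A = {k. k < n \<and> k mod d \<le> h}"
  define \<tau> where "\<tau> k = k div d * d + (h - k mod d)" for k
  have \<tau>: "\<tau> k div d = k div d" "\<tau> k mod d = h - k mod d" for k
  proof -
    have "h - k mod d < d" by (simp add: d_def less_Suc_eq_le)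
    then show "\<tau> k div d = k div d" "\<tau> k mod d = h - k mod d" by (simp_all add: \<tau>_def)
  qed
  \<comment> \<open>By \<open>le\<close> even the last block contains its first h + 1 positions, so
    \<tau> never leaves the summation range.\<close>
  have block_end: "k div d * d + h < n" if "k < n" for k
  proof -
    have "k div d \<le> (n - 1) div d" using that by (intro div_le_mono) simp
    then have "k div d * d + h \<le> (n - 1) div d * d + (n - 1) mod d"
      using le by (intro add_mono mult_right_mono) (simp_all add: d_def)
    also have "\<dots> = n - 1" by (rule div_mult_mod_eq)
    finally show ?thesis using that by simp
  qed
  have \<tau>A: "\<tau> k \<in> A" "\<tau> (\<tau> k) = k" if "k \<in> A" for k
  proof -
    have "\<tau> k < n" using block_end [of k] that by (simp add: A_def \<tau>_def)
    then show "\<tau> k \<in> A" by (simp add: A_def \<tau>)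
    have "\<tau> (\<tau> k) = k div d * d + k mod d"
      unfolding \<tau>_def [of "\<tau> k"] \<tau> using that by (simp add: A_def)
    then show "\<tau> (\<tau> k) = k" by simp
  qed
  have refl: "?f (\<tau> k) = - ?f k" if "k \<in> A" for k
  proof -
    have "?f (k div d * d + (h - k mod d)) = - ?f (k div d * d + k mod d)"
      unfolding d_def using that block_end [of k] assms
      by (intro summand_reflect) (auto simp: A_def d_def)
    then show ?thesis by (simp add: \<tau>_def)
  qed
  have "(\<Sum>k\<in>A. ?f k) = (\<Sum>k\<in>A. ?f (\<tau> k))"
    by (rule sum.reindex_bij_witness [of _ \<tau> \<tau>]) (use \<tau>A in auto)
  also have "\<dots> = - (\<Sum>k\<in>A. ?f k)"
    using refl by (simp add: sum_negf)
  finally have A0: "(\<Sum>k\<in>A. ?f k) = 0" by simp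
  have "?f k = 0" if "k \<in> {..<n} - A" for k
  proof -
    let ?t = "k mod d"
    have t: "h < ?t" "?t < d" "k < n" using that by (auto simp: A_def d_def)
    let ?N = "q_shifted_factorial (q\<^sup>2) ((q\<^sup>2)\<^sup>2)"
    let ?M = "q_shifted_factorial ((q\<^sup>2)\<^sup>2) ((q\<^sup>2)\<^sup>2)"
    have "central_term (q\<^sup>2) n (k div d * d + ?t) * ?M ?t = central_term (q\<^sup>2) n (k div d * d) * ?N ?t"
      by (rule central_term_block) (use t root in \<open>simp_all only: d_def div_mult_mod_eq\<close>)
    \<comment> \<open>As the remainder exceeds h, the product contains the factor for i = h, which
      is 1 - (q^2)^(2h+1).\<close>
    moreover have "?N ?t = 0"
    proof -
      have "1 - q\<^sup>2 * ((q\<^sup>2)\<^sup>2) ^ h = 0" using root by (simp only: square_power_shift diff_self)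
      then show ?thesis unfolding q_shifted_factorial_def using t(1) by (intro prod_zero) auto
    qed
    moreover have "?M ?t \<noteq> 0"
      by (intro q_shifted_factorial_nonzero prim) (use t(2) d_def in linarith)+
    ultimately have "central_term (q\<^sup>2) n k = 0" by simp
    then show "?f k = 0" using \<open>j \<le> r\<close> \<open>1 \<le> r\<close> by (simp add: summand_def)
  qed
  then have "(\<Sum>k<n. ?f k) = (\<Sum>k\<in>A. ?f k)"
    by (intro sum.mono_neutral_right) (auto simp: A_def)
  with A0 show ?thesis by simp
qed

text \<open>Let m be the midpoint of the last block, so a^m = -1. For k \<le> m the factor 1 + a^m
  occurs in the term. For larger k the central coefficient, zero at m, stays zero up to n -
  1.\<close>

lemma sum_summand_eq_0_even:
  fixes q :: "'a::idom"
  assumes minus: "(q\<^sup>2) ^ e = -1" and root: "(q\<^sup>2) ^ (2 * e) = 1" and "0 < e" and lt: "e \<le> (n - 1) mod (2 * e)"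
    and prim: "\<And>i. 0 < i \<Longrightarrow> i < 2 * e \<Longrightarrow> (q\<^sup>2) ^ i \<noteq> 1" and "j \<le> r" "1 \<le> r" "0 < n"
  shows "(\<Sum>k<n. summand q n r s j k) = 0"
proof (rule sum.neutral, rule ballI)
  fix k assume "k \<in> {..<n}"
  define a where "a = q\<^sup>2"
  define m where "m = (n - 1) div (2 * e) * (2 * e) + e"
  have am: "a ^ (u * (2 * e) + i) = a ^ i" for u i
    unfolding a_def by (rule power_mod_period [OF root, of _ u]) simp
  have "m \<le> (n - 1) div (2 * e) * (2 * e) + (n - 1) mod (2 * e)"
    unfolding m_def using lt by simp
  also have "\<dots> = n - 1" by (rule div_mult_mod_eq)
  finally have "m < n" using \<open>0 < n\<close> by simp
  have "central_term a n k = 0"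
  proof (cases "k \<le> m")
    case True
    then show ?thesis
      using \<open>m < n\<close> \<open>0 < e\<close> minus am by (intro central_term_eq_0 [of _ m]) (auto simp: m_def a_def)
  next
    case False
    have "gauss_binomial a (2 * (m + i)) (m + i) = 0" if "m + i < n" for i
      using that
    proof (induction i)
      case 0
      obtain l where "m = Suc l" using \<open>0 < e\<close> by (cases m) (auto simp: m_def)
      moreover have "a ^ m = -1" using am [of _ e] minus by (simp add: m_def a_def)
      ultimately have "a ^ Suc l = -1" by simp
      then have "(1 + a ^ Suc l) * gauss_binomial a (2 * l + 1) l = 0" by simp
      then show ?case
        unfolding add_0_right \<open>m = Suc l\<close> gauss_binomial_central_Suc .
    next
      case (Suc i)
      \<comment> \<open>The index has not yet reached the next block, so the factor 1 - a^(m+i+1) to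
        be cancelled is nonzero.\<close>
      have "e + Suc i < 2 * e"
      proof -
        have "n - 1 < (n - 1) div (2 * e) * (2 * e) + 2 * e"
          using \<open>0 < e\<close>
          by (metis div_mult_mod_eq mod_less_divisor nat_0_less_mult_iff nat_add_left_cancel_less
              zero_less_numeral)
        then show ?thesis using Suc.prems by (simp add: m_def)
      qed
      then have "a ^ (e + Suc i) \<noteq> 1" using prim [of "e + Suc i"] by (simp add: a_def)
      moreover have "a ^ Suc (m + i) = a ^ (e + Suc i)"
        using am [of _ "e + Suc i"] by (simp only: m_def add.assoc add_Suc_right)
      ultimately have "1 - a ^ Suc (m + i) \<noteq> 0" by (simp only: right_minus_eq) simp
      moreover have "gauss_binomial a (2 * (m + i)) (m + i) = 0" using Suc by simp
      ultimately have "gauss_binomial a (2 * (m + i) + 1) (m + i) = 0"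
        using gauss_binomial_odd_central [of a "m + i"] by (metis mult_eq_0_iff mult_zero_right)
      then show ?case using gauss_binomial_central_Suc [of a "m + i"]
        by (simp only: add_Suc_right mult_zero_right)
    qed
    from this [of "k - m"] False \<open>k \<in> {..<n}\<close> show ?thesis by (simp add: central_term_def)
  qed
  then show "summand q n r s j k = 0"
    using \<open>j \<le> r\<close> \<open>1 \<le> r\<close> by (simp add: summand_def a_def)
qed

section \<open>Root multiplicities of the modulus\<close>

text \<open>This d is the multiplicative order, with d = 0 for elements that are not roots of unity,
  because 0 divides only 0.\<close>

lemma power_eq_1_iff_order_dvd:
  fixes a :: "'a::comm_ring_1"
  shows "\<exists>d. \<forall>i. a ^ i = 1 \<longleftrightarrow> d dvd i"
proof (cases "\<exists>i>0. a ^ i = 1")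
  case False
  then have "a ^ i = 1 \<longleftrightarrow> 0 dvd i" for i by (metis dvd_0_left_iff neq0_conv power_0)
  then show ?thesis by blast
next
  case True
  define d where "d = (LEAST i. 0 < i \<and> a ^ i = 1)"
  have d: "0 < d" "a ^ d = 1"
    using LeastI_ex [OF True] by (simp_all add: d_def)
  have "a ^ i = 1 \<longleftrightarrow> d dvd i" for i
  proof -
    have "a ^ i = a ^ (i mod d)"
      by (rule power_mod_period [OF d(2), of _ "i div d"]) simp
    moreover have "a ^ (i mod d) \<noteq> 1" if "i mod d \<noteq> 0"
      using not_less_Least [of "i mod d" "\<lambda>i. 0 < i \<and> a ^ i = 1"] that d(1)
      by (auto simp flip: d_def)
    ultimately show ?thesis by (cases "i mod d = 0") (auto simp: mod_eq_0_iff_dvd)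
  qed
  then show ?thesis by blast
qed

text \<open>If d = 2 e, then (q^2)^e is a square root of 1 other than 1, hence -1. If d is odd, it
  is coprime to 2 and squaring q^2 preserves the order.\<close>

lemma sum_summand_eq_0:
  fixes q :: "'a::{idom,ring_char_0}"
  assumes ord: "\<And>i. (q\<^sup>2) ^ i = 1 \<longleftrightarrow> d dvd i" and "2 \<le> d" "d \<le> 2 * ((n - 1) mod d) + 1"
    and "j \<le> r" "1 \<le> r" "0 < n"
  shows "(\<Sum>k<n. summand q n r s j k) = 0"
proof (cases "even d")
  case True
  then obtain e where e: "d = 2 * e" by (elim evenE)
  have "((q\<^sup>2) ^ e)\<^sup>2 = 1" using ord [of d] by (simp add: e mult.commute flip: power_mult)
  moreover have "(q\<^sup>2) ^ e \<noteq> 1" using ord [of e] \<open>2 \<le> d\<close> by (auto simp: e)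
  ultimately have "(q\<^sup>2) ^ e = -1" by (simp add: power2_eq_1_iff)
  moreover have "(q\<^sup>2) ^ i \<noteq> 1" if "0 < i" "i < 2 * e" for i
    using ord [of i] that by (auto simp: e dest: dvd_imp_le)
  moreover have "(q\<^sup>2) ^ (2 * e) = 1" using ord [of d] by (simp only: e dvd_refl)
  moreover have "0 < e" "e \<le> (n - 1) mod (2 * e)" using assms(2,3) by (simp_all add: e)
  ultimately show ?thesis
    using assms(4-6) by (intro sum_summand_eq_0_even [of _ e])
next
  case False
  then obtain h where h: "d = 2 * h + 1" by (elim oddE)
  have "((q\<^sup>2)\<^sup>2) ^ i \<noteq> 1" if "0 < i" "i < d" for i
  proof -
    have "\<not> d dvd 2 * i"
      using that False by (auto simp: coprime_dvd_mult_right_iff dest: dvd_imp_le)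
    then show ?thesis unfolding power_mult [symmetric, of "q\<^sup>2"] ord .
  qed
  moreover have "(q\<^sup>2) ^ (2 * h + 1) = 1" using ord [of d] by (simp only: h dvd_refl)
  moreover have "0 < h" "h \<le> (n - 1) mod (2 * h + 1)" using assms(2,3) by (simp_all add: h)
  ultimately show ?thesis
    using assms(4-6) unfolding h by (intro sum_summand_eq_0_odd [of _ h])
qed

text \<open>The derivative can vanish only at 0, where the polynomial is 1. The constant c covers
  both 1 + X^m and 1 - X^m.\<close>

lemma rsquarefree_one_plus_smult_power:
  fixes c :: "'a::field_char_0"
  assumes "0 < m" "c \<noteq> 0"
  shows "rsquarefree (1 + smult c ([:0, 1:] ^ m))"
  unfolding rsquarefree_roots
  using assms by (auto simp: pderiv_add pderiv_smult pderiv_power pderiv_pCons power_0_left)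

lemma order_one_minus_power:
  fixes z :: "'a::field_char_0"
  assumes "0 < m"
  shows "order z (1 - [:0, 1:] ^ m) = (if z ^ m = 1 then 1 else 0)"
proof -
  let ?p = "1 - [:0, 1::'a:] ^ m"
  have "rsquarefree ?p"
    using rsquarefree_one_plus_smult_power [OF assms, of "-1 :: 'a"] by simp
  then have "?p \<noteq> 0" "order z ?p = 0 \<or> order z ?p = 1" unfolding rsquarefree_def by blast+
  moreover have "poly ?p z = 0 \<longleftrightarrow> z ^ m = 1" by auto
  ultimately show ?thesis using order_root [of ?p z] by auto
qed

text \<open>The factor 1 - X^(2i) has a simple root at z exactly when d divides i, and m div d
  counts such i from 1 to m; for d = 0 this is 0, as it should be.\<close>

lemma order_q_shifted_factorial:
  fixes z :: "'a::field_char_0"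
  assumes "\<And>i. (z\<^sup>2) ^ i = 1 \<longleftrightarrow> d dvd i"
  shows "order z (q_shifted_factorial ([:0, 1:]\<^sup>2) ([:0, 1:]\<^sup>2) m) = m div d"
proof (induction m)
  case (Suc m)
  let ?x = "[:0, 1::'a:]\<^sup>2"
  have x: "?x * ?x ^ m = [:0, 1:] ^ (2 * Suc m)"
    by (simp only: power_mult power_Suc)
  have "q_shifted_factorial ?x ?x (Suc m) \<noteq> 0"
    by (intro q_shifted_factorial_nonzero pCons_0_1_square_power_ne_1)
  then have "order z (q_shifted_factorial ?x ?x (Suc m))
      = m div d + order z (1 - [:0, 1:] ^ (2 * Suc m))"
    unfolding q_shifted_factorial_Suc x Suc.IH [symmetric] by (rule order_mult)
  also have "order z (1 - [:0, 1:] ^ (2 * Suc m)) = (if d dvd Suc m then 1 else 0)"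
    by (subst order_one_minus_power) (simp_all only: power_mult assms, simp)
  also have "m div d + \<dots> = Suc m div d"
    by (simp add: div_Suc mod_eq_0_iff_dvd)
  finally show ?case .
qed simp

definition reduced_modulus :: "'a::comm_ring_1 \<Rightarrow> nat \<Rightarrow> 'a" where
  "reduced_modulus x n = q_integer x n * gauss_binomial x (2 * n - 1) (n - 1)"

lemma (in comm_ring_1_hom) hom_reduced_modulus [simp]:
  "h (reduced_modulus x n) = reduced_modulus (h x) n"
  by (simp add: reduced_modulus_def)

text \<open>Multiplying the \<open>q\<close>-integer by 1 - x gives 1 - x^n, the factor that
  completes the shifted factorial of length n - 1 to length n.\<close>

lemma reduced_modulus_mult:
  assumes "0 < n"
  shows "reduced_modulus x n * q_shifted_factorial x x 1 * q_shifted_factorial x x (n - 1) ^ 2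
    = q_shifted_factorial x x (2 * n - 1)"
proof -
  obtain m where n: "n = Suc m" using assms by (cases n) auto
  let ?p = "q_shifted_factorial x x"
  have "reduced_modulus x n * ?p 1 * ?p m ^ 2
      = gauss_binomial x (2 * n - 1) m * ?p m * (?p m * (q_integer x n * (1 - x)))"
    by (simp add: reduced_modulus_def n q_shifted_factorial_Suc power2_eq_square mult_ac
        del: gauss_binomial.simps)
  also have "\<dots> = gauss_binomial x (m + Suc m) m * ?p m * ?p (Suc m)"
    unfolding q_integer_mult by (simp add: n q_shifted_factorial_Suc mult_2)
  also have "\<dots> = ?p (m + Suc m)" by (rule gauss_binomial_mult_q_shifted_factorials)
  finally show ?thesis by (simp add: n mult_2)
qed

text \<open>Counting roots gives e = (2n-1) div d - 1 div d - 2 ((n-1) div d). Writing n - 1 with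
  remainder v, this is (2v+1) div d - 1 div d for d > 0, at most 1 because 2 v + 1 < 2 d.\<close>

lemma reduced_modulus_order:
  fixes z :: "'a::field_char_0"
  assumes ord: "\<And>i. (z\<^sup>2) ^ i = 1 \<longleftrightarrow> d dvd i" and "0 < n"
  defines "e \<equiv> order z (reduced_modulus ([:0, 1:]\<^sup>2) n)"
  shows "e \<le> 1" and "0 < e \<Longrightarrow> 2 \<le> d \<and> d \<le> 2 * ((n - 1) mod d) + 1"
proof -
  define x where "x = [:0, 1::'a:]\<^sup>2"
  let ?p = "q_shifted_factorial x x"
  define v where "v = (n - 1) mod d"
  have "?p (2 * n - 1) \<noteq> 0"
    unfolding x_def by (intro q_shifted_factorial_nonzero pCons_0_1_square_power_ne_1)
  then have ne: "reduced_modulus x n * ?p 1 * ?p (n - 1) ^ 2 \<noteq> 0"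
    using reduced_modulus_mult [OF \<open>0 < n\<close>, of x] by simp
  have e: "e = order z (reduced_modulus x n)"
    by (simp only: e_def x_def)
  have p: "order z (?p m) = m div d" for m
    unfolding x_def by (rule order_q_shifted_factorial [OF ord])
  have "(2 * n - 1) div d = order z (reduced_modulus x n * ?p 1 * ?p (n - 1) ^ 2)"
    unfolding reduced_modulus_mult [OF \<open>0 < n\<close>] by (rule p [symmetric])
  also have "\<dots> = e + 1 div d + 2 * ((n - 1) div d)"
    using ne by (simp add: order_mult power2_eq_square p e)
  finally have eq: "e + 1 div d + 2 * ((n - 1) div d) = (2 * n - 1) div d" by (rule sym)
  note eq
  also have "2 * n - 1 = 2 * v + 1 + 2 * ((n - 1) div d) * d"
  proof -
    have "n = (n - 1) div d * d + v + 1" using \<open>0 < n\<close> by (simp add: v_def)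
    then show ?thesis by simp
  qed
  finally have split: "e + 1 div d + 2 * ((n - 1) div d)
      = (2 * v + 1 + 2 * ((n - 1) div d) * d) div d" .
  have *: "e + 1 div d = (2 * v + 1) div d" if "0 < d"
  proof -
    have "(2 * v + 1 + 2 * ((n - 1) div d) * d) div d = 2 * ((n - 1) div d) + (2 * v + 1) div d"
      using that by (intro div_mult_self1) simp
    with split show ?thesis by linarith
  qed
  show "e \<le> 1"
  proof (cases "d = 0")
    case False
    then have "v < d" unfolding v_def by (intro mod_less_divisor) simp
    then have "2 * v + 1 < 2 * d" by linarith
    then have "(2 * v + 1) div d < 2" using False by (simp add: less_mult_imp_div_less)
    with * False show ?thesis by simp
  next
    case True
    with eq show ?thesis by simp
  qed
  \<comment> \<open>For d = 0 all quotients are 0, and for d = 1 the formula reads e + 1 = 1; both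
    contradict e > 0.\<close>
  assume "0 < e"
  with eq have "0 < d" by (cases d) auto
  with * \<open>0 < e\<close> have "d \<le> 2 * v + 1" by (metis add_gr_0 div_less not_less less_irrefl)
  moreover have "d \<noteq> 1" using * \<open>0 < e\<close> by (auto simp: v_def)
  ultimately show "2 \<le> d \<and> d \<le> 2 * ((n - 1) mod d) + 1" using \<open>0 < d\<close> by (simp add: v_def)
qed

section \<open>Divisibility from complex roots and descent to the rationals\<close>

text \<open>A root of \<open>p\<close>, which exists by the fundamental theorem of algebra, is also
  one of \<open>s\<close>; cancelling the linear factor lowers both orders alike and the degree by
  one.\<close>

lemma complex_poly_dvd_if_order_le:
  fixes p s :: "complex poly"
  assumes "p \<noteq> 0" "s \<noteq> 0" "\<And>z. order z p \<le> order z s"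
  shows "p dvd s"
  using assms
proof (induction "degree p" arbitrary: p s)
  case 0
  then show ?case by (metis is_unit_iff_degree unit_imp_dvd)
next
  case (Suc m)
  then obtain z where z: "poly p z = 0"
    using fundamental_theorem_of_algebra [of p] constant_degree [of p] by auto
  then have "order z p \<noteq> 0" using Suc.prems order_root by blast
  then have "order z s \<noteq> 0" using Suc.prems(3) [of z] by simp
  then have "poly s z = 0" by (simp add: order_root)
  with z obtain p' s' where p': "p = [:- z, 1:] * p'" and s': "s = [:- z, 1:] * s'"
    by (auto simp: poly_eq_0_iff_dvd elim!: dvdE)
  have nz: "[:- z, 1:] * p' \<noteq> 0" "[:- z, 1:] * s' \<noteq> 0" using Suc.prems p' s' by simp_all
  have "order y p' \<le> order y s'" for y
    using Suc.prems(3) [of y] unfolding p' s' by (simp only: order_mult [OF nz(1)] order_mult [OF nz(2)])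
  moreover have "m = degree p'"
    using Suc.hyps(2) nz unfolding p' by (subst (asm) degree_mult_eq) auto
  ultimately have "p' dvd s'" using nz by (intro Suc.hyps(1)) auto
  then show ?case unfolding p' s' by (rule mult_dvd_mono [OF dvd_refl])
qed

text \<open>Division with remainder survives the field extension, so the image of \<open>p\<close>
  divides that of the remainder, whose degree is too small unless it is 0.\<close>

lemma map_poly_of_rat_dvdD:
  fixes p s :: "rat poly"
  assumes "(map_poly of_rat p :: 'a::field_char_0 poly) dvd map_poly of_rat s"
  shows "p dvd s"
proof (cases "p = 0")
  case True
  with assms show ?thesis by (simp add: map_poly_eq_0_iff)
next
  case False
  let ?h = "map_poly of_rat :: rat poly \<Rightarrow> 'a poly"
  interpret comm_ring_1_hom ?h by (rule comm_ring_1_hom_map_poly_of_rat)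
  have deg: "degree (?h p) = degree p" for p by (rule degree_map_poly) simp
  have "?h s = ?h (s div p) * ?h p + ?h (s mod p)"
    by (metis div_mult_mod_eq hom_add hom_mult)
  with assms have dvd: "?h p dvd ?h (s mod p)" by (metis dvd_add_right_iff dvd_triv_right)
  have "s mod p = 0"
  proof (rule ccontr)
    assume *: "s mod p \<noteq> 0"
    then have "?h (s mod p) \<noteq> 0" by (simp add: map_poly_eq_0_iff)
    with dvd have "degree p \<le> degree (s mod p)" using dvd_imp_degree_le deg by metis
    with * False show False using degree_mod_less [of p s] by simp
  qed
  then show ?thesis by (simp add: mod_eq_0_iff_dvd)
qed

text \<open>Orders are compared at each complex z. Away from the roots of \<open>A\<close> only
  \<open>N\<close> counts, with order at most 1, so it suffices that the sum vanishes where
  \<open>N\<close> does.\<close>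

lemma modulus_dvd_sum_summand:
  assumes "2 \<le> n" "1 \<le> r" "j \<le> r"
  shows "(1 + [:0, 1::rat:] ^ (2 * n - 2)) ^ (2 * r - 1 - j) * reduced_modulus ([:0, 1:]\<^sup>2) n
    dvd (\<Sum>k<n. summand [:0, 1:] n r s j k)"
proof -
  let ?X = "[:0, 1::complex:]"
  define A where "A = 1 + ?X ^ (2 * n - 2)"
  define N where "N = reduced_modulus (?X\<^sup>2) n"
  define S where "S = (\<Sum>k<n. summand ?X n r s j k)"
  have "0 < n" using assms by simp
  have A_rsquarefree: "rsquarefree A"
    using rsquarefree_one_plus_smult_power [of "2 * n - 2" "1 :: complex"] assms by (simp add: A_def)
  then have "A \<noteq> 0" by (simp add: rsquarefree_def)
  have "q_shifted_factorial (?X\<^sup>2) (?X\<^sup>2) (2 * n - 1) \<noteq> 0"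
    by (intro q_shifted_factorial_nonzero pCons_0_1_square_power_ne_1)
  then have "N \<noteq> 0"
    using reduced_modulus_mult [OF \<open>0 < n\<close>, of "?X\<^sup>2"] by (auto simp: N_def)
  have A_dvd: "A ^ (2 * r - j) dvd S"
  proof -
    have "A = 1 + (?X\<^sup>2) ^ (n - 1)"
      by (simp only: A_def power_mult [symmetric] diff_mult_distrib2) simp
    then have "A dvd central_term (?X\<^sup>2) n k" if "k < n" for k
      using one_plus_power_dvd_central_term that assms by metis
    then show ?thesis
      unfolding S_def summand_def by (intro dvd_sum dvd_mult dvd_power_same) simp
  qed
  have "A ^ (2 * r - 1 - j) * N dvd S"
  proof (cases "S = 0")
    case False
    show ?thesis
    proof (rule complex_poly_dvd_if_order_le)
      show nz: "A ^ (2 * r - 1 - j) * N \<noteq> 0" using \<open>A \<noteq> 0\<close> \<open>N \<noteq> 0\<close> by simp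
      show "S \<noteq> 0" by fact
      fix z :: complex
      obtain d where ord: "\<And>i. (z\<^sup>2) ^ i = 1 \<longleftrightarrow> d dvd i"
        using power_eq_1_iff_order_dvd [of "z\<^sup>2"] by blast
      note e = reduced_modulus_order [OF ord \<open>0 < n\<close>, folded N_def]
      have order_A: "order z (A ^ m) = m * order z A" for m
        using \<open>A \<noteq> 0\<close> by (induction m) (simp_all add: order_mult)
      have "order z (A ^ (2 * r - 1 - j) * N) = (2 * r - 1 - j) * order z A + order z N"
        by (simp only: order_mult [OF nz] order_A)
      also have "\<dots> \<le> order z S"
      proof (cases "order z A = 0")
        case True
        have "poly S z = 0" if "0 < order z N"
        proof -
          interpret comm_ring_1_hom "\<lambda>p. poly p z" by (rule comm_ring_1_hom_poly)
          have "poly S z = (\<Sum>k<n. summand z n r s j k)" by (simp add: S_def)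
          also have "\<dots> = 0"
            using e(2) that assms by (intro sum_summand_eq_0 [OF ord]) auto
          finally show ?thesis .
        qed
        then have "0 < order z N \<Longrightarrow> 0 < order z S" using \<open>S \<noteq> 0\<close> order_root by blast
        with True e(1) show ?thesis by (cases "order z N = 0") auto
      next
        \<comment> \<open>Here A^(2r-j) divides the sum, and its spare factor \<open>A\<close> pays
          for a possible simple root of \<open>N\<close>.\<close>
        case A1: False
        have "order z A = 0 \<or> order z A = 1" using A_rsquarefree unfolding rsquarefree_def by blast
        with A1 have "order z A = 1" by simp
        moreover have "order z (A ^ (2 * r - j)) \<le> order z S"
          using A_dvd \<open>S \<noteq> 0\<close> by (rule dvd_imp_order_le [rotated])
        ultimately show ?thesis using e(1) assms unfolding order_A by simp
      qed
      finally show "order z (A ^ (2 * r - 1 - j) * N) \<le> order z S" .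
    qed
  qed simp
  moreover interpret comm_ring_1_hom "map_poly of_rat :: rat poly \<Rightarrow> complex poly"
    by (rule comm_ring_1_hom_map_poly_of_rat)
  have "map_poly of_rat [:0, 1:] = ?X" by (simp add: map_poly_pCons)
  ultimately show ?thesis
    by (intro map_poly_of_rat_dvdD [where 'a = complex])
      (simp only: hom_mult hom_power hom_add hom_one hom_sum hom_summand hom_reduced_modulus
        A_def N_def S_def)
qed

section \<open>The congruences\<close>

lemma qvar_nonzero: "qvar \<noteq> 0"
  by (simp add: qvar_def)

lemma qvar_power_ne_1:
  assumes "0 < i" shows "(qvar\<^sup>2) ^ i \<noteq> 1"
proof -
  interpret comm_ring_1_hom "to_fract :: rat poly \<Rightarrow> rat poly fract"
    by (rule comm_ring_1_hom_to_fract)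
  have "(qvar\<^sup>2) ^ i = to_fract ([:0, 1:] ^ (2 * i))"
    by (simp only: qvar_def hom_power power_mult)
  also have "\<dots> \<noteq> to_fract 1"
    using pCons_0_1_power_ne_1 [of "2 * i"] assms by (simp only: to_fract_eq_iff) simp
  finally show ?thesis by simp
qed

text \<open>Multiplication by \<open>q\<close> to the power \<open>(4 s + 4) n\<close> clears the negative powers of \<open>q\<close>.\<close>

lemma summand_qvar:
  assumes "k \<le> n"
  shows "(-1) ^ (j * k) * qvar powi (2 * int j * (int k)^2 + (2 * int r - 4 * int s - 4) * int k)
      * q_integer qvar (4*k+1) ^ (2*s) * q_integer (qvar^2) (4*k+1)
      * q_binomial (qvar^2) (2*k) k ^ (2*r-j)
      * q_shifted_factorial (- (qvar ^ (2*k+2))) (qvar^2) (n-k-1) ^ (4*r-2*j)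
    = summand qvar n r s j k / qvar ^ ((4 * s + 4) * n)"
proof -
  let ?a = "2 * j * k\<^sup>2 + 2 * r * k + (4 * s + 4) * (n - k)"
  let ?b = "(4 * s + 4) * n"
  have "2 * int j * (int k)^2 + (2 * int r - 4 * int s - 4) * int k = int ?a - int ?b"
  proof -
    obtain i where "n = k + i" using assms le_Suc_ex by blast
    then show ?thesis by (simp add: algebra_simps)
  qed
  then have "qvar powi (2 * int j * (int k)^2 + (2 * int r - 4 * int s - 4) * int k)
      = qvar ^ ?a / qvar ^ ?b"
    by (simp only: power_int_diff [OF disjI1 [OF qvar_nonzero]] power_int_of_nat)
  moreover have "q_binomial (qvar^2) (2*k) k = gauss_binomial (qvar^2) (2*k) k"
    by (intro gauss_binomial_eq_q_binomial [symmetric] qvar_power_ne_1) simp_all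
  moreover have "qvar ^ (2*k+2) = (qvar\<^sup>2) ^ Suc k"
    by (simp only: power_mult [symmetric]) simp
  moreover have "4 * r - 2 * j = 2 * (2 * r - j)" by simp
  ultimately show ?thesis
    by (simp only: summand_def central_term_def power_mult_distrib power_mult times_divide_eq_left
        times_divide_eq_right mult_ac)
qed

text \<open>With p = c + X g, the combination X^m p - X^(m+1) g equals c X^m, so a common divisor of
  X^(m+1) and \<open>p\<close> divides X^m, and one descends to a unit.\<close>

lemma coprime_power_pCons_0_1:
  fixes p :: "'a::field poly"
  assumes "poly p 0 \<noteq> 0"
  shows "coprime ([:0, 1:] ^ m) p"
proof (rule coprimeI)
  let ?X = "[:0, 1::'a:]"
  fix d assume d: "d dvd ?X ^ m" "d dvd p"
  obtain c g where p: "p = pCons c g" by (cases p)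
  with assms have "c \<noteq> 0" by simp
  from d(1) show "is_unit d"
  proof (induction m)
    case (Suc m)
    have "d dvd ?X ^ m * p - ?X ^ Suc m * g" using d(2) Suc.prems by (intro dvd_diff dvd_mult dvd_mult2)
    also have "?X ^ m * p - ?X ^ Suc m * g = smult c (?X ^ m)" by (simp add: p algebra_simps)
    finally show ?case using \<open>c \<noteq> 0\<close> by (intro Suc.IH) (simp add: dvd_smult_iff)
  qed simp
qed

theorem theorem1p1:
  fixes n r s :: nat
  assumes "n \<ge> 2" and "r \<ge> 1"
  shows
    "ratfun_cong
       (\<Sum>k=0..n-1. (-1) ^ k
          * qvar powi (2 * (int k)^2 + (2 * int r - 4 * int s - 4) * int k)
          * q_integer qvar (4*k+1) ^ (2*s) * q_integer (qvar^2) (4*k+1)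
          * q_binomial (qvar^2) (2*k) k ^ (2*r-1)
          * q_shifted_factorial (- (qvar ^ (2*k+2))) (qvar^2) (n-k-1) ^ (4*r-2))
       0
       ((1 + qvar ^ (2*n-2)) ^ (2*r-2) * q_integer (qvar^2) n * q_binomial (qvar^2) (2*n-1) (n-1))
     \<and>
     ratfun_cong
       (1 / (1 + qvar ^ (2*n-2)) *
        (\<Sum>k=0..n-1. qvar powi ((2 * int r - 4 * int s - 4) * int k)
          * q_integer qvar (4*k+1) ^ (2*s) * q_integer (qvar^2) (4*k+1)
          * q_binomial (qvar^2) (2*k) k ^ (2*r)
          * q_shifted_factorial (- (qvar ^ (2*k+2))) (qvar^2) (n-k-1) ^ (4*r)))
       0
       ((1 + qvar ^ (2*n-2)) ^ (2*r-2) * q_integer (qvar^2) n * q_binomial (qvar^2) (2*n-1) (n-1))"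
    (is "ratfun_cong ?L1 0 ?M \<and> ratfun_cong (1 / ?A * ?L2) 0 ?M")
proof -
  interpret comm_ring_1_hom "to_fract :: rat poly \<Rightarrow> rat poly fract"
    by (rule comm_ring_1_hom_to_fract)
  define X where "X = [:0, 1::rat:]"
  define A where "A = 1 + X ^ (2 * n - 2)"
  define P where "P = A ^ (2 * r - 2) * reduced_modulus (X\<^sup>2) n"
  let ?S = "\<lambda>j. \<Sum>k<n. summand X n r s j k"
  have X: "to_fract X = qvar" by (simp only: X_def qvar_def)
  have A: "to_fract A = ?A" by (simp add: A_def X)
  have "poly A 0 = 1" using assms by (simp add: A_def X_def power_0_left)
  have M: "?M = to_fract P"
    using gauss_binomial_eq_q_binomial [of "qvar\<^sup>2" "n - 1" "2 * n - 1"] qvar_power_ne_1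
    by (simp add: P_def A reduced_modulus_def X mult.assoc)
  \<comment> \<open>Every factor of \<open>P\<close> has constant term 1, so the power of
    \<open>q\<close> in the denominator is admissible.\<close>
  have coprime: "coprime (X ^ m) P" for m
  proof -
    interpret ev: comm_ring_1_hom "\<lambda>p. poly p (0::rat)" by (rule comm_ring_1_hom_poly)
    have "q_integer 0 n = (1::rat)"
      using q_integer_mult [of "0::rat" n] assms by (simp add: power_0_left)
    then have "poly P 0 = 1"
      using \<open>poly A 0 = 1\<close> gauss_binomial_at_0 [of "n - 1" "2 * n - 1", where 'a = rat]
      by (simp add: P_def X_def reduced_modulus_def)
    then show ?thesis unfolding X_def by (intro coprime_power_pCons_0_1) simp
  qed
  have cong: "ratfun_cong B 0 ?M"
    if B: "B = to_fract P * to_fract U / qvar ^ m" for B U m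
    unfolding ratfun_cong_def M
  proof (intro exI conjI)
    show "B - 0 = to_fract P * to_fract U / to_fract (X ^ m)" by (simp add: B X)
    show "X ^ m \<noteq> 0" by (simp add: X_def)
    show "coprime (X ^ m) P" by (rule coprime)
  qed (rule refl)
  have range: "{0..n - 1} = {..<n}" using assms by auto
  let ?c = "qvar ^ ((4 * s + 4) * n)"
  have L1: "?L1 = to_fract (?S 1) / ?c"
    unfolding range hom_sum hom_summand X sum_divide_distrib
    by (intro sum.cong refl) (use summand_qvar [of _ n 1 r s] in \<open>simp add: less_imp_le\<close>)
  have L2: "?L2 = to_fract (?S 0) / ?c"
    unfolding range hom_sum hom_summand X sum_divide_distrib
    by (intro sum.cong refl) (use summand_qvar [of _ n 0 r s] in \<open>simp add: less_imp_le\<close>)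
  have "P dvd ?S 1"
    using modulus_dvd_sum_summand [of n r 1 s] assms
    by (simp only: P_def A_def X_def diff_diff_left one_add_one)
  then obtain U where "?S 1 = P * U" by (elim dvdE)
  then have 1: "ratfun_cong ?L1 0 ?M"
    by (intro cong) (simp only: L1 hom_mult)
  \<comment> \<open>The case j = 0 provides one more factor \<open>A\<close> than the modulus has;
    it cancels the denominator of the second sum.\<close>
  have "A ^ (2 * r - 1) * reduced_modulus (X\<^sup>2) n dvd ?S 0"
    using modulus_dvd_sum_summand [of n r 0 s] assms by (simp add: A_def X_def)
  then obtain W where W: "?S 0 = A ^ (2 * r - 1) * reduced_modulus (X\<^sup>2) n * W"
    by (elim dvdE)
  have "2 * r - 1 = Suc (2 * r - 2)" using assms by simp
  with W have "?S 0 = A * (P * W)" by (simp add: P_def mult_ac)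
  moreover have "?A \<noteq> 0"
    using \<open>poly A 0 = 1\<close> unfolding A [symmetric] to_fract_eq_0_iff by auto
  ultimately have "1 / ?A * ?L2 = to_fract P * to_fract W / ?c"
    unfolding L2 by (simp add: A)
  then have 2: "ratfun_cong (1 / ?A * ?L2) 0 ?M" by (rule cong)
  from 1 2 show ?thesis by (rule conjI)
qed

end
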